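(* For all sufficiently small $c\in(0,1)$ (that is, there is $c_0\in(0,1)$ such that for all $0<c<c_0$), the function $z\mapsto\dfrac{1}{\sqrt{z+2c}}$ is not the $S$-transform of a probability measure on $\mathbb{R}_{+}$.
   Context: $\mathbb{R}_+=[0,\infty)$. For a probability measure $\mu$ on $\mathbb{R}_+$ with $\mu\ne\delta_0$, let $\Psi_\mu(z)=\int\frac{zx}{1-zx}\mu(\mathrm{d}x)$. This function has an inverse $\chi_\mu$ on $\Psi_\mu(i\mathbb{C}^+)$ with values in the left half-plane $i\mathbb{C}^+$, and the $S$-transform of $\mu$ is $S_\mu(z)=\chi_\mu(z)\frac{1+z}{z}$ on $\Psi_\mu(i\mathbb{C}^+)$; this domain contains the interval $(\mu(\{0\})-1,0)$. A function $f$ is the $S$-transform of $\mu$ if $S_\mu=f$ on an interval $(-\varepsilon,0)$ for some $\varepsilon>0$. The square root is the principal branch (positive on positive reals). *)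

theory Defs
  imports "HOL-Probability.Probability"
begin

text \<open>Measures on \<open>[0,\<infinity>)\<close> are represented as Borel measures on the whole real line
  that are concentrated on \<open>[0,\<infinity>)\<close>.\<close>

definition nonneg_prob_measure :: "real measure \<Rightarrow> bool" where
  "nonneg_prob_measure \<mu> \<longleftrightarrow> prob_space \<mu> \<and> sets \<mu> = sets borel \<and> (AE x in \<mu>. 0 \<le> x)"

text \<open>This is \<open>i\<complex>\<^sup>+\<close>, the image of the upper half-plane under multiplication by \<open>i\<close>.\<close>

definition left_half_plane :: "complex set" where
  "left_half_plane = {z. Re z < 0}"

definition Psi_transform :: "real measure \<Rightarrow> complex \<Rightarrow> complex" where
  "Psi_transform \<mu> z =
     (LINT x|\<mu>. z * complex_of_real x / (1 - z * complex_of_real x))"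

definition S_domain :: "real measure \<Rightarrow> complex set" where
  "S_domain \<mu> = Psi_transform \<mu> ` left_half_plane"

text \<open>If \<open>\<mu>\<close> is a probability measure on \<open>[0,\<infinity>)\<close> other than \<open>\<delta>\<^sub>0\<close>, then
  \<open>Psi_transform \<mu>\<close> is injective on the left half-plane, so \<open>chi_transform \<mu>\<close> is its genuine
  inverse on \<open>S_domain \<mu>\<close>. Outside \<open>S_domain \<mu>\<close> the values of \<open>chi_transform\<close> and \<open>S_transform\<close>
  are meaningless.\<close>

definition chi_transform :: "real measure \<Rightarrow> complex \<Rightarrow> complex" where
  "chi_transform \<mu> = inv_into left_half_plane (Psi_transform \<mu>)"

definition S_transform :: "real measure \<Rightarrow> complex \<Rightarrow> complex" where
  "S_transform \<mu> z = chi_transform \<mu> z * ((1 + z) / z)"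

text \<open>Since \<open>S_domain \<mu>\<close> contains the interval \<open>(\<mu>({0}) - 1, 0)\<close>, requiring the interval
  \<open>(-\<epsilon>, 0)\<close> to lie in \<open>S_domain \<mu>\<close> only restricts the choice of \<open>\<epsilon>\<close>; it keeps the junk values
  of \<open>S_transform\<close> out of the comparison.\<close>

definition is_S_transform_of :: "(complex \<Rightarrow> complex) \<Rightarrow> real measure \<Rightarrow> bool" where
  "is_S_transform_of f \<mu> \<longleftrightarrow>
     nonneg_prob_measure \<mu> \<and> \<mu> \<noteq> return borel 0 \<and>
     (\<exists>\<epsilon>>0. \<forall>t\<in>{-\<epsilon><..<0::real}.
        complex_of_real t \<in> S_domain \<mu> \<and>
        S_transform \<mu> (complex_of_real t) = f (complex_of_real t))"

end

theory Submission
  imports Defs "HOL-Complex_Analysis.Complex_Analysis" "HOL-Real_Asymp.Real_Asymp"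
begin

text \<open>If \<open>1 / sqrt (z + 2c)\<close> is the \<open>S\<close>-transform of \<open>\<mu>\<close>, then \<open>w\<^sup>2 (1 + \<Psi>)\<^sup>2 (\<Psi> + 2c) = \<Psi>\<^sup>2\<close>
  for \<open>\<Psi> = \<Psi>\<^sub>\<mu>(w)\<close> and \<open>w < 0\<close> near \<open>0\<close>, hence on the whole left half-plane by analytic
  continuation. For \<open>c < 1/2\<close> this forces \<open>\<Psi>\<^sub>\<mu>(-y) + 2c = O(y\<^sup>-\<^sup>2)\<close> as \<open>y \<rightarrow> \<infinity>\<close>. But
  \<open>\<Psi>\<^sub>\<mu>(-y) + 1\<close> is the integral of \<open>1 / (1 + y x)\<close>, which cannot approach its limit faster
  than \<open>1/y\<close> unless it is constant. So every \<open>c < 1/2\<close> is excluded.\<close>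

section \<open>Holomorphy of the transform on the left half-plane\<close>

text \<open>Both bounds come from the real part of \<open>1 - z * x\<close>, which is
  \<open>1 + (- Re z) * x\<close> with both summands nonnegative. The first keeps denominators away
  from 0, the second absorbs a factor \<open>x\<close> in a numerator.\<close>

lemma norm_one_minus_mult_ge:
  fixes z :: complex and x :: real
  assumes "Re z < 0" "0 \<le> x"
  shows "1 \<le> norm (1 - z * of_real x)" "- Re z * x \<le> norm (1 - z * of_real x)"
proof -
  have "Re z * x \<le> 0"
    using assms by (simp add: mult_nonpos_nonneg)
  moreover have "1 - Re z * x \<le> norm (1 - z * of_real x)"
    using complex_Re_le_cmod[of "1 - z * of_real x"] by simp
  ultimately show "1 \<le> norm (1 - z * of_real x)" "- Re z * x \<le> norm (1 - z * of_real x)"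
    by auto
qed

lemma integrable_Psi_integrand:
  assumes "nonneg_prob_measure \<mu>" "Re z < 0"
  shows "integrable \<mu> (\<lambda>x. z * complex_of_real x / (1 - z * complex_of_real x))"
proof -
  interpret prob_space \<mu>
    using assms by (simp add: nonneg_prob_measure_def)
  have [measurable_cong]: "sets \<mu> = sets borel"
    using assms by (simp add: nonneg_prob_measure_def)
  have "AE x in \<mu>. 0 \<le> x"
    using assms by (simp add: nonneg_prob_measure_def)
  then have "AE x in \<mu>. norm (z * complex_of_real x / (1 - z * complex_of_real x)) \<le> norm z / - Re z"
  proof eventually_elim
    case (elim x)
    have "norm z * x * - Re z \<le> norm z * norm (1 - z * of_real x)"
      using mult_left_mono[OF norm_one_minus_mult_ge(2)[OF assms(2) elim], of "norm z"]
      by (simp add: mult_ac)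
    moreover have "0 < norm (1 - z * of_real x)"
      using norm_one_minus_mult_ge(1)[OF assms(2) elim] by linarith
    ultimately show ?case
      using assms(2) elim by (simp add: norm_divide norm_mult divide_simps)
  qed
  then show ?thesis
    by (intro integrable_const_bound) auto
qed

text \<open>The difference quotient at \<open>z\<close> is again an integral, and dominated
  convergence passes to the limit under the integral sign.\<close>

lemma Psi_transform_holomorphic:
  assumes "nonneg_prob_measure \<mu>"
  shows "Psi_transform \<mu> holomorphic_on left_half_plane"
proof -
  interpret prob_space \<mu>
    using assms by (simp add: nonneg_prob_measure_def)
  have [measurable_cong]: "sets \<mu> = sets borel"
    using assms by (simp add: nonneg_prob_measure_def)
  have pos: "AE x in \<mu>. 0 \<le> x"
    using assms by (simp add: nonneg_prob_measure_def)
  have "open left_half_plane"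
    by (simp add: left_half_plane_def open_halfspace_Re_lt)
  have "(Psi_transform \<mu> has_field_derivative
      (LINT x|\<mu>. of_real x / ((1 - z * of_real x) * (1 - z * of_real x)))) (at z)"
    if z: "Re z < 0" for z
  proof -
    \<comment> \<open>The difference quotient of the integrand after cancelling
      \<open>w - z\<close>, so that it also makes sense at \<open>w = z\<close>.\<close>
    let ?q = "\<lambda>w x. complex_of_real x / ((1 - w * of_real x) * (1 - z * of_real x))"
    have quotient: "(Psi_transform \<mu> w - Psi_transform \<mu> z) / (w - z) = (LINT x|\<mu>. ?q w x)"
      if w: "Re w < 0" "w \<noteq> z" for w
    proof -
      have "(LINT x|\<mu>. ?q w x)
        = (LINT x|\<mu>. (w * of_real x / (1 - w * of_real x) - z * of_real x / (1 - z * of_real x)) / (w - z))"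
      proof (rule integral_cong_AE)
        show "AE x in \<mu>. ?q w x =
          (w * of_real x / (1 - w * of_real x) - z * of_real x / (1 - z * of_real x)) / (w - z)"
          using pos
        proof eventually_elim
          case (elim x)
          have "1 - w * of_real x \<noteq> 0" "1 - z * of_real x \<noteq> 0"
            using norm_one_minus_mult_ge(1)[OF w(1) elim] norm_one_minus_mult_ge(1)[OF z elim]
            by auto
          then show ?case
            using w(2) by (simp add: divide_simps) (simp add: algebra_simps)
        qed
      qed auto
      then show ?thesis
        using integrable_Psi_integrand[OF assms w(1)] integrable_Psi_integrand[OF assms z]
        by (simp add: Psi_transform_def)
    qed
    have "((\<lambda>w. (Psi_transform \<mu> w - Psi_transform \<mu> z) / (w - z)) \<longlongrightarrow> (LINT x|\<mu>. ?q z x)) (at z)"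
      unfolding tendsto_at_iff_sequentially comp_def
    proof (intro allI impI)
      fix X assume X: "\<forall>i. X i \<in> UNIV - {z}" "X \<longlonglongrightarrow> z"
      have "\<forall>\<^sub>F n in sequentially. X n \<in> left_half_plane"
        using \<open>open left_half_plane\<close> X(2) z
        by (intro topological_tendstoD) (auto simp: left_half_plane_def)
      then obtain N where N: "Re (X n) < 0" if "n \<ge> N" for n
        by (auto simp: eventually_sequentially left_half_plane_def)
      have "(\<lambda>n. LINT x|\<mu>. ?q (X (n + N)) x) \<longlonglongrightarrow> (LINT x|\<mu>. ?q z x)"
      \<comment> \<open>Shifting by \<open>N\<close> puts the whole sequence in the half-plane.
        There the factor at \<open>z\<close> has norm at least \<open>- Re z * x\<close> and the
        factor at \<open>X (n + N)\<close> has norm at least 1, so the dominating constant is free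
        of \<open>n\<close> and \<open>x\<close>.\<close>
      proof (rule integral_dominated_convergence[where w = "\<lambda>_. 1 / - Re z"])
        show "AE x in \<mu>. (\<lambda>n. ?q (X (n + N)) x) \<longlonglongrightarrow> ?q z x"
          using pos
        proof eventually_elim
          case (elim x)
          have "1 - z * of_real x \<noteq> 0"
            using norm_one_minus_mult_ge(1)[OF z elim] by auto
          then show ?case
            by (intro tendsto_intros LIMSEQ_ignore_initial_segment X) auto
        qed
        show "AE x in \<mu>. norm (?q (X (n + N)) x) \<le> 1 / - Re z" for n
          using pos
        proof eventually_elim
          case (elim x)
          have "- Re z * x * 1 \<le> norm (1 - z * of_real x) * norm (1 - X (n + N) * of_real x)"
            using norm_one_minus_mult_ge[OF z elim] elim z
              norm_one_minus_mult_ge(1)[OF N elim, of "n + N"]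
            by (intro mult_mono) auto
          moreover have "norm (1 - z * of_real x) > 0" "norm (1 - X (n + N) * of_real x) > 0"
            using norm_one_minus_mult_ge(1)[OF z elim]
              norm_one_minus_mult_ge(1)[OF N elim, of "n + N"] by linarith+
          ultimately show ?case
            using z elim by (simp add: norm_divide norm_mult divide_simps mult_ac)
        qed
      qed auto
      moreover have "(LINT x|\<mu>. ?q (X (n + N)) x)
          = (Psi_transform \<mu> (X (n + N)) - Psi_transform \<mu> z) / (X (n + N) - z)" for n
        using quotient[of "X (n + N)"] N[of "n + N"] X(1) by auto
      ultimately have "(\<lambda>n. (Psi_transform \<mu> (X (n + N)) - Psi_transform \<mu> z) / (X (n + N) - z))
          \<longlonglongrightarrow> (LINT x|\<mu>. ?q z x)"
        by simp
      then show "(\<lambda>n. (Psi_transform \<mu> (X n) - Psi_transform \<mu> z) / (X n - z))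
          \<longlonglongrightarrow> (LINT x|\<mu>. ?q z x)"
        by (rule LIMSEQ_offset)
    qed
    then show ?thesis
      by (simp add: has_field_derivative_iff)
  qed
  then show ?thesis
    using \<open>open left_half_plane\<close>
    by (auto simp: holomorphic_on_open left_half_plane_def)
qed

section \<open>The algebraic equation and its analytic continuation\<close>

text \<open>Squaring removes the square root, so both sides are polynomial in \<open>w\<close> and
  \<open>Psi_transform \<mu> w\<close>. The identity theorem then applies without any choice of
  branch off the real axis.\<close>

lemma Psi_transform_algebraic:
  assumes S: "is_S_transform_of (\<lambda>z. 1 / csqrt (z + 2 * complex_of_real c)) \<mu>"
    and c: "0 < c" "c < 1/2" and w: "Re w < 0"
  shows "w\<^sup>2 * (1 + Psi_transform \<mu> w)\<^sup>2 * (Psi_transform \<mu> w + 2 * of_real c)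
    = (Psi_transform \<mu> w)\<^sup>2"
proof -
  have \<mu>: "nonneg_prob_measure \<mu>"
    using S by (simp add: is_S_transform_of_def)
  obtain \<epsilon> where \<epsilon>: "\<epsilon> > 0" and
    dom: "\<And>t. t \<in> {-\<epsilon><..<0::real} \<Longrightarrow> complex_of_real t \<in> S_domain \<mu>" and
    eq: "\<And>t. t \<in> {-\<epsilon><..<0::real} \<Longrightarrow> chi_transform \<mu> (of_real t) * ((1 + of_real t) / of_real t)
           = 1 / csqrt (of_real t + 2 * of_real c)"
    using S unfolding is_S_transform_of_def S_transform_def by blast
  \<comment> \<open>Halving makes \<open>b < \<epsilon>\<close> and \<open>b < 2 * c\<close> strict.
    Since \<open>2 * c < 1\<close>, both \<open>t + 2 * c\<close> and \<open>1 + t\<close> are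
    positive for \<open>t\<close> in \<open>{-b..-b/2}\<close>.\<close>
  define b where "b = min \<epsilon> (2 * c) / 2"
  have b: "0 < b" "b < \<epsilon>" "b < 2 * c"
    using \<epsilon> c by (auto simp: b_def min_def)
  \<comment> \<open>The value of \<open>chi_transform \<mu> t\<close> obtained by solving the
    equation for the S-transform.\<close>
  define G where "G t = complex_of_real (t / ((1 + t) * sqrt (t + 2 * c)))" for t
  \<comment> \<open>The parameter interval stays away from 0, where \<open>G\<close> would leave the
    open half-plane. Compactness of \<open>U\<close> then keeps a limit point inside it.\<close>
  define U where "U = G ` {-b..-b/2}"
  have chi: "chi_transform \<mu> (of_real t) = G t" if "t \<in> {-b..-b/2}" for t
  proof -
    have t: "t \<in> {-\<epsilon><..<0}" "t + 2 * c > 0" "1 + t > 0"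
      using that b c by auto
    have "csqrt (of_real t + 2 * of_real c) = of_real (sqrt (t + 2 * c))"
      using t(2) csqrt_of_real_nonneg[of "t + 2 * c"] by simp
    then have "chi_transform \<mu> (of_real t) * of_real ((1 + t) / t) = of_real (1 / sqrt (t + 2 * c))"
      using eq[OF t(1)] by simp
    moreover have "complex_of_real ((1 + t) / t) \<noteq> 0"
      using t by (subst of_real_eq_0_iff) simp
    ultimately have "chi_transform \<mu> (of_real t) = of_real (1 / sqrt (t + 2 * c)) / of_real ((1 + t) / t)"
      by (metis nonzero_mult_div_cancel_right)
    then show ?thesis
      by (simp add: G_def mult.commute)
  qed
  have G_inverse: "Re (G t) < 0" "Psi_transform \<mu> (G t) = of_real t" if t: "t \<in> {-b..-b/2}" for t
  proof -
    \<comment> \<open>Membership in the image makes the value of \<open>inv_into\<close> a genuine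
      preimage of \<open>t\<close>.\<close>
    have "complex_of_real t \<in> Psi_transform \<mu> ` left_half_plane"
      using dom[of t] t b by (auto simp: S_domain_def)
    then have "chi_transform \<mu> (of_real t) \<in> left_half_plane"
      "Psi_transform \<mu> (chi_transform \<mu> (of_real t)) = of_real t"
      unfolding chi_transform_def by (auto intro: inv_into_into f_inv_into_f)
    then show "Re (G t) < 0" "Psi_transform \<mu> (G t) = of_real t"
      by (simp_all add: chi[OF t] left_half_plane_def)
  qed
  have "compact U"
    unfolding U_def G_def using b c
    by (intro compact_continuous_image continuous_intros) auto
  moreover have "infinite U"
  proof -
    \<comment> \<open>\<open>Psi_transform \<mu>\<close> is a left inverse of \<open>G\<close> on
      this interval.\<close>
    have "inj_on G {-b..-b/2}"
      using G_inverse(2) by (metis inj_onI of_real_eq_iff)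
    moreover have "infinite {-b..-b/2}"
      using b by (simp add: infinite_Icc)
    ultimately show ?thesis
      by (simp add: U_def finite_image_iff)
  qed
  ultimately obtain \<xi> where \<xi>: "\<xi> \<in> U" "\<xi> islimpt U"
    by (meson compact_eq_Bolzano_Weierstrass order_refl)
  have U: "U \<subseteq> left_half_plane"
    using G_inverse(1) by (auto simp: U_def left_half_plane_def)
  let ?g = "\<lambda>w. w\<^sup>2 * (1 + Psi_transform \<mu> w)\<^sup>2 * (Psi_transform \<mu> w + 2 * of_real c)
    - (Psi_transform \<mu> w)\<^sup>2"
  have "?g w = 0"
  proof (rule analytic_continuation[of ?g left_half_plane U \<xi>])
    show "?g holomorphic_on left_half_plane"
      by (intro holomorphic_intros Psi_transform_holomorphic \<mu>)
    show "open left_half_plane" "connected left_half_plane"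
      by (auto simp: left_half_plane_def open_halfspace_Re_lt convex_halfspace_Re_lt
          intro: convex_connected)
    show "w \<in> left_half_plane" "\<xi> \<in> left_half_plane"
      using w \<xi> U by (auto simp: left_half_plane_def)
    fix u assume "u \<in> U"
    then obtain t where t: "t \<in> {-b..-b/2}" "u = G t"
      by (auto simp: U_def)
    have "t + 2 * c > 0" "1 + t > 0"
      using t b c by auto
    then have "(t / ((1 + t) * sqrt (t + 2 * c)))\<^sup>2 * (1 + t)\<^sup>2 * (t + 2 * c) - t\<^sup>2 = 0"
      by (simp add: power_divide power_mult_distrib)
    then have "complex_of_real ((t / ((1 + t) * sqrt (t + 2 * c)))\<^sup>2 * (1 + t)\<^sup>2 * (t + 2 * c) - t\<^sup>2) = 0"
      by (simp only: of_real_0)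
    then have "(G t)\<^sup>2 * (1 + of_real t)\<^sup>2 * (of_real t + 2 * of_real c) - (of_real t)\<^sup>2 = 0"
      by (simp add: G_def)
    then show "?g u = 0"
      by (simp add: t(2) G_inverse(2)[OF t(1)])
  qed (use U \<xi> in auto)
  then show ?thesis
    by simp
qed

section \<open>Real integrals on the negative axis\<close>

lemma integrable_inverse_one_plus:
  assumes "nonneg_prob_measure \<mu>" "0 < y"
  shows "integrable \<mu> (\<lambda>x. 1 / (1 + y * x))"
proof -
  interpret prob_space \<mu>
    using assms by (simp add: nonneg_prob_measure_def)
  have [measurable_cong]: "sets \<mu> = sets borel"
    using assms by (simp add: nonneg_prob_measure_def)
  have "AE x in \<mu>. 0 \<le> x"
    using assms by (simp add: nonneg_prob_measure_def)
  then have "AE x in \<mu>. norm (1 / (1 + y * x)) \<le> 1"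
    by eventually_elim (use assms in \<open>auto simp: divide_le_eq add_nonneg_nonneg\<close>)
  then show ?thesis
    by (intro integrable_const_bound) auto
qed

text \<open>At \<open>z = - y\<close> the integrand equals \<open>1 / (1 + y * x) - 1\<close>, and
  the total mass is 1. This turns the algebraic equation into one for a real function of
  \<open>y\<close>.\<close>

lemma Psi_transform_neg_real:
  assumes "nonneg_prob_measure \<mu>" "0 < y"
  shows "Psi_transform \<mu> (- of_real y) = of_real ((LINT x|\<mu>. 1 / (1 + y * x)) - 1)"
proof -
  interpret prob_space \<mu>
    using assms by (simp add: nonneg_prob_measure_def)
  have [measurable_cong]: "sets \<mu> = sets borel"
    using assms by (simp add: nonneg_prob_measure_def)
  have pos: "AE x in \<mu>. 0 \<le> x"
    using assms by (simp add: nonneg_prob_measure_def)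
  have "Psi_transform \<mu> (- of_real y) = (LINT x|\<mu>. complex_of_real (1 / (1 + y * x) - 1))"
    unfolding Psi_transform_def
  proof (rule integral_cong_AE)
    show "AE x in \<mu>. - of_real y * complex_of_real x / (1 - - of_real y * complex_of_real x)
        = complex_of_real (1 / (1 + y * x) - 1)"
      using pos
    proof eventually_elim
      case (elim x)
      have "1 + y * x > 0"
        using elim assms by (simp add: add_pos_nonneg)
      then have "1 / (1 + y * x) - 1 = - y * x / (1 + y * x)"
        by (simp add: divide_simps)
      then show ?case
        by simp
    qed
  qed auto
  then show ?thesis
    using integrable_inverse_one_plus[OF assms]
    by (simp only: integral_complex_of_real) (simp add: prob_space)
qed

text \<open>Comparing \<open>y\<close> with \<open>2 y\<close> avoids identifying the limit \<open>y \<rightarrow> \<infinity>\<close> with \<open>\<mu>({0})\<close>.\<close>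

lemma integral_inverse_one_plus_slow:
  assumes "nonneg_prob_measure \<mu>" "0 < y"
  shows "(LINT x|\<mu>. 1 / (1 + x)) - (LINT x|\<mu>. 1 / (1 + 2 * y * x))
    \<le> 2 * y * ((LINT x|\<mu>. 1 / (1 + y * x)) - (LINT x|\<mu>. 1 / (1 + 2 * y * x)))"
proof -
  have pos: "AE x in \<mu>. 0 \<le> x"
    using assms by (simp add: nonneg_prob_measure_def)
  have int: "integrable \<mu> (\<lambda>x. 1 / (1 + x))" "integrable \<mu> (\<lambda>x. 1 / (1 + y * x))"
    "integrable \<mu> (\<lambda>x. 1 / (1 + 2 * y * x))"
    using integrable_inverse_one_plus[OF assms(1), of 1] integrable_inverse_one_plus[OF assms]
      integrable_inverse_one_plus[OF assms(1), of "2 * y"] assms(2) by simp_all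
  have "(LINT x|\<mu>. 1 / (1 + x) - 1 / (1 + 2 * y * x))
      \<le> (LINT x|\<mu>. 2 * y * (1 / (1 + y * x) - 1 / (1 + 2 * y * x)))"
  proof (rule integral_mono_AE)
    show "AE x in \<mu>. 1 / (1 + x) - 1 / (1 + 2 * y * x)
        \<le> 2 * y * (1 / (1 + y * x) - 1 / (1 + 2 * y * x))"
      using pos
    proof eventually_elim
      case (elim x)
      have p: "1 + x > 0" "1 + y * x > 0" "1 + 2 * y * x > 0"
        using elim assms by (simp_all add: add_pos_nonneg)
      \<comment> \<open>Over the common denominator the numerator of the difference is
        \<open>x\<close> times a sum of two squares and \<open>y * x\<close>, hence
        nonnegative.\<close>
      have "2 * y * (1 / (1 + y * x) - 1 / (1 + 2 * y * x)) - (1 / (1 + x) - 1 / (1 + 2 * y * x))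
        = x * (y\<^sup>2 + (y - 1)\<^sup>2 + y * x) / ((1 + x) * (1 + y * x) * (1 + 2 * y * x))"
        using p by (simp add: divide_simps) (simp add: algebra_simps power2_eq_square)
      also have "\<dots> \<ge> 0"
        using p elim assms(2)
        by (intro divide_nonneg_nonneg mult_nonneg_nonneg add_nonneg_nonneg) auto
      finally show ?case
        by simp
    qed
  qed (use int in auto)
  then show ?thesis
    using int by simp
qed

section \<open>Contradiction between the two decay rates\<close>

theorem proposition10:
  shows "\<exists>c0::real. 0 < c0 \<and> c0 < 1 \<and>
    (\<forall>c::real. 0 < c \<and> c < c0 \<longrightarrow>
      \<not> (\<exists>\<mu>. is_S_transform_of (\<lambda>z. 1 / csqrt (z + 2 * complex_of_real c)) \<mu>))"
\<comment> \<open>The threshold \<open>1/2\<close> is what makes \<open>a = 1 - 2 * c\<close>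
  positive below.\<close>
proof (rule exI[of _ "1/2"], safe)
  fix c :: real and \<mu>
  assume c: "0 < c" "c < 1/2"
    and S: "is_S_transform_of (\<lambda>z. 1 / csqrt (z + 2 * complex_of_real c)) \<mu>"
  have \<mu>: "nonneg_prob_measure \<mu>"
    using S by (simp add: is_S_transform_of_def)
  interpret prob_space \<mu>
    using \<mu> by (simp add: nonneg_prob_measure_def)
  have pos: "AE x in \<mu>. 0 \<le> x"
    using \<mu> by (simp add: nonneg_prob_measure_def)
  \<comment> \<open>Here \<open>q y\<close> is \<open>1 + Psi_transform \<mu> (- y)\<close>, so the
    factor \<open>Psi + 2 * c\<close> of the algebraic equation becomes
    \<open>q y - a\<close>.\<close>
  define q where "q y = (LINT x|\<mu>. 1 / (1 + y * x))" for y
  define a where "a = 1 - 2 * c"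
  have a: "0 < a" "a < 1"
    using c by (auto simp: a_def)
  have alg: "y\<^sup>2 * (q y)\<^sup>2 * (q y - a) = (1 - q y)\<^sup>2" if y: "0 < y" for y
  proof -
    have "complex_of_real (y\<^sup>2 * (q y)\<^sup>2 * (q y - a)) = of_real ((1 - q y)\<^sup>2)"
      using Psi_transform_algebraic[OF S c, of "- of_real y"] y
      by (simp add: Psi_transform_neg_real[OF \<mu> y] q_def a_def power2_commute algebra_simps)
    then show ?thesis
      by (simp only: of_real_eq_iff)
  qed
  have q_ge: "a < q y" and q_le: "q y \<le> 1" if y: "0 < y" for y
  proof -
    have "AE x in \<mu>. 1 / (1 + y * x) \<le> 1"
      using pos by eventually_elim (use y in \<open>auto simp: divide_le_eq add_nonneg_nonneg\<close>)
    then show "q y \<le> 1"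
      unfolding q_def
      by (intro integral_le_const integrable_inverse_one_plus[OF \<mu> y]) auto
    \<comment> \<open>For \<open>q y = 1\<close> the equation would read
      \<open>y\<^sup>2 * (1 - a) = 0\<close>. Hence its right side is positive, which forces
      \<open>q y - a\<close> to be positive too.\<close>
    have "q y \<noteq> 1"
      using alg[OF y] y a by auto
    then have "0 < y\<^sup>2 * (q y)\<^sup>2 * (q y - a)"
      using alg[OF y] by simp
    moreover have "0 \<le> y\<^sup>2 * (q y)\<^sup>2"
      by simp
    ultimately show "a < q y"
      by (metis diff_gt_0_iff_gt zero_less_mult_pos less_le mult_zero_left)
  qed
  \<comment> \<open>In the equation, \<open>q y > a > 0\<close> bounds the factor
    \<open>(q y)\<^sup>2\<close> below by \<open>a\<^sup>2\<close>, and the right side is at most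
    1.\<close>
  have decay: "q y - a \<le> 1 / (y\<^sup>2 * a\<^sup>2)" if y: "0 < y" for y
  proof -
    have "y\<^sup>2 * a\<^sup>2 * (q y - a) \<le> y\<^sup>2 * (q y)\<^sup>2 * (q y - a)"
      using q_ge[OF y] a by (intro mult_right_mono mult_left_mono power_mono) auto
    also have "\<dots> \<le> 1"
      using alg[OF y] q_ge[OF y] q_le[OF y] a by (simp add: power_le_one)
    finally show ?thesis
      using y a by (simp add: field_simps)
  qed
  \<comment> \<open>The first summand is \<open>decay\<close> at \<open>2 * y\<close>. The second is
    \<open>2 * y\<close> times \<open>decay\<close> at \<open>y\<close>, after replacing
    \<open>q (2 * y)\<close> by its lower bound \<open>a\<close>.\<close>
  have bound: "q 1 - a \<le> 1 / (4 * y\<^sup>2 * a\<^sup>2) + 2 * y * (1 / (y\<^sup>2 * a\<^sup>2))" if y: "0 < y" for y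
  proof -
    have "q 1 - q (2 * y) \<le> 2 * y * (q y - q (2 * y))"
      using integral_inverse_one_plus_slow[OF \<mu> y] by (simp add: q_def)
    also have "\<dots> \<le> 2 * y * (1 / (y\<^sup>2 * a\<^sup>2))"
      using y decay[OF y] q_ge[of "2 * y"] by (intro mult_left_mono) auto
    finally show ?thesis
      using decay[of "2 * y"] y by (simp add: power_mult_distrib)
  qed
  \<comment> \<open>The upper bound is of order \<open>1 / y\<close>, while \<open>q 1 - a\<close>
    does not depend on \<open>y\<close>. The limit gives \<open>q 1 - a\<close> at most 0, against
    the strict inequality \<open>a < q 1\<close>.\<close>
  have "((\<lambda>y. 1 / (4 * y\<^sup>2 * a\<^sup>2) + 2 * y * (1 / (y\<^sup>2 * a\<^sup>2))) \<longlongrightarrow> 0) at_top"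
    using a by real_asymp
  then have "q 1 - a \<le> 0"
    by (rule tendsto_lowerbound)
      (use bound in \<open>auto intro: eventually_mono[OF eventually_gt_at_top[of 0]]\<close>)
  with q_ge[of 1] show False
    by simp
qed auto

end
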